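(* Let $0<q<1$, $n\ge1$, and let $\lambda,\mu$ be partitions with at most $n$ parts. Then \[ \sum_{T\in\mathrm{GT}_n(\lambda,\mu)}q^{|T|}=q^{|\mu|-b(\lambda)}\,s_\mu(q^{\delta_n})\,s_\lambda(q^{\mu+\delta_n})\prod_{j=1}^n\frac{(q;q)_{n-j}}{(q;q)_{\lambda_j+n-j}}, \] equivalently \[ \sum_{T\in\mathrm{GT}_n(\lambda,\mu)}q^{|T|}=\frac{q^{|\mu|-b(\delta_n+\lambda)}}{\prod_{j=1}^n(q;q)_{\lambda_j+n-j}}\,s_\lambda(q^{\mu+\delta_n})\,\overline\Delta(q^{\mu+\delta_n}). \]
   Context: An $(n,\lambda,\mu)$-Gelfand–Tsetlin pattern is an array $(x_{i,j})$ indexed by $1\le j\le n$, $1-\lambda_j\le i\le n+1-j$, of nonnegative integers such that $x_{i,j+1}\ge x_{i,j}\ge x_{i+1,j}$ whenever the indices involved lie in the index set, and $x_{i,n+1-i}=\mu_i$ for $1\le i\le n$; $\mathrm{GT}_n(\lambda,\mu)$ is the set of these and $|T|$ is the sum of entries. $\delta_n=(n-1,\dots,1,0)$, $b(\nu)=\sum_i(i-1)\nu_i$, $|\mu|=\sum\mu_i$, $q^{\nu}=(q^{\nu_1},\dots,q^{\nu_n})$. $s_\lambda(x_1,\dots,x_n)=\det(x_j^{\lambda_i+n-i})/\det(x_j^{n-i})$, $\overline\Delta(x)=\prod_{i<j}(x_j-x_i)$, $(q;q)_k=\prod_{l=1}^k(1-q^l)$. *)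

theory Defs
  imports "HOL-Analysis.Infinite_Sum" "Jordan_Normal_Form.Determinant"
begin

text \<open>
  Finite sequences such as \<open>\<nu>\<^sub>1, \<dots>, \<nu>\<^sub>n\<close> are functions on \<open>nat\<close> read from index 1 onwards;
  the value at 0 is never inspected.
\<close>

definition partition_parts_le :: "nat \<Rightarrow> (nat \<Rightarrow> nat) \<Rightarrow> bool" where
  "partition_parts_le n \<nu> \<longleftrightarrow> (\<forall>i\<ge>1. \<nu> (i + 1) \<le> \<nu> i) \<and> (\<forall>i>n. \<nu> i = 0)"

definition part_size :: "nat \<Rightarrow> (nat \<Rightarrow> nat) \<Rightarrow> nat" where
  "part_size n \<nu> = (\<Sum>i = 1..n. \<nu> i)"

definition b_stat :: "nat \<Rightarrow> (nat \<Rightarrow> nat) \<Rightarrow> nat" where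
  "b_stat n \<nu> = (\<Sum>i = 1..n. (i - 1) * \<nu> i)"

text \<open>The staircase \<open>(n - 1, \<dots>, 1, 0)\<close>.\<close>

definition \<delta> :: "nat \<Rightarrow> nat \<Rightarrow> nat" where
  "\<delta> n i = n - i"

definition q_pow :: "'a::monoid_mult \<Rightarrow> (nat \<Rightarrow> nat) \<Rightarrow> nat \<Rightarrow> 'a" where
  "q_pow q \<nu> i = q ^ \<nu> i"

definition qq_poch :: "'a::comm_ring_1 \<Rightarrow> nat \<Rightarrow> 'a" where
  "qq_poch q k = (\<Prod>l = 1..k. 1 - q ^ l)"

text \<open>
  The matrices are indexed from 0, hence the shifts by one.  The bialternant quotient is the
  Schur polynomial only where \<open>x\<^sub>1, \<dots>, x\<^sub>n\<close> are pairwise distinct (otherwise it is 0 by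
  the convention on division by 0).  This covers the points \<open>q\<^bsup>\<nu> + \<delta> n\<^esup>\<close> for a partition \<open>\<nu>\<close>
  and \<open>0 < q < 1\<close>, because the exponents are strictly decreasing.
\<close>

definition schur :: "nat \<Rightarrow> (nat \<Rightarrow> nat) \<Rightarrow> (nat \<Rightarrow> 'a::field) \<Rightarrow> 'a" where
  "schur n \<nu> x =
     det (mat n n (\<lambda>(i, j). x (j + 1) ^ (\<nu> (i + 1) + (n - (i + 1))))) /
     det (mat n n (\<lambda>(i, j). x (j + 1) ^ (n - (i + 1))))"

text \<open>The Vandermonde product with differences \<open>x\<^sub>j - x\<^sub>i\<close> for \<open>i < j\<close>.\<close>

definition Delta_bar :: "nat \<Rightarrow> (nat \<Rightarrow> 'a::comm_ring_1) \<Rightarrow> 'a" where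
  "Delta_bar n x = (\<Prod>(i, j) \<in> {(i, j). 1 \<le> i \<and> i < j \<and> j \<le> n}. x j - x i)"

text \<open>
  The first index of a pattern may be zero or negative, so it is an integer.  Arrays are
  total functions that are \<open>undefined\<close> outside the index set, so that distinct functions are
  distinct arrays.
\<close>

definition GT_index :: "nat \<Rightarrow> (nat \<Rightarrow> nat) \<Rightarrow> (int \<times> nat) set" where
  "GT_index n lam = {(i, j). 1 \<le> j \<and> j \<le> n \<and> 1 - int (lam j) \<le> i \<and> i \<le> int n + 1 - int j}"

lemma finite_GT_index: "finite (GT_index n lam)"
proof -
  have "GT_index n lam \<subseteq> (\<Union>j\<in>{1..n}. {1 - int (lam j)..int n + 1 - int j} \<times> {j})"
    by (auto simp: GT_index_def)
  then show ?thesis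
    by (rule finite_subset) auto
qed

definition GT :: "nat \<Rightarrow> (nat \<Rightarrow> nat) \<Rightarrow> (nat \<Rightarrow> nat) \<Rightarrow> (int \<times> nat \<Rightarrow> nat) set" where
  "GT n lam mu =
     {T \<in> GT_index n lam \<rightarrow>\<^sub>E UNIV.
        (\<forall>i j. (i, j) \<in> GT_index n lam \<and> (i, j + 1) \<in> GT_index n lam \<longrightarrow> T (i, j) \<le> T (i, j + 1)) \<and>
        (\<forall>i j. (i, j) \<in> GT_index n lam \<and> (i + 1, j) \<in> GT_index n lam \<longrightarrow> T (i + 1, j) \<le> T (i, j)) \<and>
        (\<forall>i\<in>{1..n}. T (int i, n + 1 - i) = mu i)}"

definition GT_size :: "nat \<Rightarrow> (nat \<Rightarrow> nat) \<Rightarrow> (int \<times> nat \<Rightarrow> nat) \<Rightarrow> nat" where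
  "GT_size n lam T = (\<Sum>p\<in>GT_index n lam. T p)"

end

theory Submission
  imports Defs "HOL-Analysis.Elementary_Metric_Spaces"
begin

text \<open>
  The entries of a pattern on the antidiagonal \<open>i + j = n + 1\<close> are \<open>mu\<close>.  Removing them leaves a
  pattern whose outermost antidiagonal \<open>mu'\<close> interlaces with \<open>mu\<close>: a pattern for \<open>n - 1\<close> and the
  same \<open>lam\<close> if \<open>lam n = 0\<close>, and (after a shift of the rows) one for \<open>n\<close> and \<open>lam - 1\<close>
  otherwise.  With \<open>l = lam + \<delta> n\<close> and \<open>y = mu + \<delta> n\<close> the claimed value is, up to explicit factors,
  the determinant of \<open>q ^ (l i * y j)\<close>.  The entries of \<open>mu'\<close> range over independent intervals, so
  the determinant is summed column by column; each column is a geometric sum, whose value is a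
  difference of two consecutive columns of the determinant for \<open>mu\<close>, and column operations remove
  these differences.
\<close>

section \<open>Sums of products and determinants over independent ranges\<close>

text \<open>The distributive law for possibly infinite sums, by splitting off one coordinate of
  \<open>PiE\<close> at a time. Nonnegativity replaces a separate hypothesis of joint summability:
  for nonnegative terms, summability of the iterated sums suffices.\<close>

lemma has_sum_prod_PiE_nonneg:
  fixes f :: "'i \<Rightarrow> 'b \<Rightarrow> real"
  assumes "finite A"
    and "\<And>x. x \<in> A \<Longrightarrow> (f x has_sum g x) (B x)"
    and "\<And>x y. x \<in> A \<Longrightarrow> y \<in> B x \<Longrightarrow> 0 \<le> f x y"
  shows "((\<lambda>h. \<Prod>x\<in>A. f x (h x)) has_sum (\<Prod>x\<in>A. g x)) (PiE A B)"
  using assms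
proof (induction A rule: finite_induct)
  case empty
  show ?case by (simp add: has_sum_finite_iff)
next
  case (insert a A)
  let ?P = "\<lambda>h. \<Prod>x\<in>A. f x (h x)" and ?G = "\<Prod>x\<in>A. g x"
  have IH: "(?P has_sum ?G) (PiE A B)"
    using insert by auto
  have inner: "((\<lambda>h. f a y * ?P h) has_sum f a y * ?G) (PiE A B)" for y
    using IH by (rule has_sum_cmult_right)
  have outer: "((\<lambda>y. f a y * ?G) has_sum g a * ?G) (B a)"
    using insert.prems by (intro has_sum_cmult_left) auto
  have nonneg: "0 \<le> f a y * ?P h" if "y \<in> B a" "h \<in> PiE A B" for y h
  proof (intro mult_nonneg_nonneg prod_nonneg)
    show "0 \<le> f x (h x)" if "x \<in> A" for x
      using that insert.prems(2) \<open>h \<in> PiE A B\<close> by (simp add: PiE_mem)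
  qed (use that insert.prems(2) in simp)
  have "((\<lambda>(y, h). f a y * ?P h) has_sum g a * ?G) (B a \<times> PiE A B)"
  proof (rule has_sum_SigmaI[where g = "\<lambda>y. f a y * ?G"])
    show "(\<lambda>(y, h). f a y * ?P h) summable_on B a \<times> PiE A B"
      by (rule summable_on_SigmaI[where g = "\<lambda>y. f a y * ?G"])
         (simp_all add: inner nonneg has_sum_imp_summable[OF outer])
  qed (simp_all add: inner outer)
  also have "?this \<longleftrightarrow> ((\<lambda>h. \<Prod>x\<in>insert a A. f x (h x)) has_sum g a * ?G) (PiE (insert a A) B)"
  \<comment> \<open>Restricting \<open>h\<close> to \<open>A\<close> makes it
    \<open>undefined\<close> at \<open>a\<close> again, as membership in \<open>PiE A B\<close>
    demands.\<close>
  proof (rule has_sum_reindex_bij_witness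
      [where i = "\<lambda>h. (h a, restrict h A)" and j = "\<lambda>(y, h). h(a := y)"])
    fix yh assume "yh \<in> B a \<times> PiE A B"
    then obtain y h where yh: "yh = (y, h)" "y \<in> B a" "h \<in> PiE A B" by auto
    have "restrict (h(a := y)) A = h"
      using insert.hyps PiE_arb[OF yh(3)] by (intro ext) (simp add: restrict_def)
    then show "(\<lambda>h. (h a, restrict h A)) ((\<lambda>(y, h). h(a := y)) yh) = yh"
      by (simp add: yh)
    show "(\<lambda>(y, h). h(a := y)) yh \<in> PiE (insert a A) B"
      using yh by (auto simp: PiE_iff extensional_def)
    have "(\<Prod>x\<in>A. f x ((h(a := y)) x)) = ?P h"
      using insert.hyps by (intro prod.cong) auto
    then show "(\<Prod>x\<in>insert a A. f x ((\<lambda>(y, h). h(a := y)) yh x)) = (\<lambda>(y, h). f a y * ?P h) yh"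
      using insert.hyps by (simp add: yh)
  next
    fix h assume h: "h \<in> PiE (insert a A) B"
    show "(\<lambda>(y, h). h(a := y)) (h a, restrict h A) = h"
      using PiE_arb[OF h] by (intro ext) (simp add: restrict_def)
    show "(h a, restrict h A) \<in> B a \<times> PiE A B"
      using h by (auto simp: PiE_iff)
  qed auto
  finally show ?case
    using insert.hyps by simp
qed

lemma has_sum_sum:
  fixes f :: "'i \<Rightarrow> 'a \<Rightarrow> 'b::topological_comm_monoid_add"
  assumes "finite I" and "\<And>i. i \<in> I \<Longrightarrow> (f i has_sum s i) A"
  shows "((\<lambda>x. \<Sum>i\<in>I. f i x) has_sum (\<Sum>i\<in>I. s i)) A"
  using assms by (induction I rule: finite_induct) (auto intro!: has_sum_add)

text \<open>In the Leibniz expansion each term takes exactly one entry from every column, and column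
  \<open>j\<close> depends on \<open>h\<close> only through \<open>h (Suc j)\<close>. So every term
  is a product over independent coordinates. The signs stay outside these products, which is why
  nonnegative entries are enough.\<close>

lemma has_sum_det_PiE:
  fixes f :: "nat \<Rightarrow> nat \<Rightarrow> 'b \<Rightarrow> real"
  assumes "\<And>i j. i < n \<Longrightarrow> j < n \<Longrightarrow> (f i j has_sum g i j) (B (Suc j))"
    and "\<And>i j v. i < n \<Longrightarrow> j < n \<Longrightarrow> 0 \<le> f i j v"
  shows "((\<lambda>h. det (mat n n (\<lambda>(i, j). f i j (h (Suc j))))) has_sum det (mat n n (\<lambda>(i, j). g i j)))
           (PiE {1..n} B)"
proof -
  have expand: "det (mat n n (\<lambda>(i, j). a i j))
      = (\<Sum>p | p permutes {0..<n}. signof p * (\<Prod>x\<in>{1..n}. a (p (x - 1)) (x - 1)))"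
    for a :: "nat \<Rightarrow> nat \<Rightarrow> real"
  proof -
    \<comment> \<open>Transposing lets the product run over columns, the index that carries the
      summation variable; the shift by one then matches \<open>PiE {1..n} B\<close>.\<close>
    have "det (mat n n (\<lambda>(i, j). a i j)) = det (mat n n (\<lambda>(i, j). a j i))"
      by (subst det_transpose[of _ n, symmetric]) (auto intro!: arg_cong[of _ _ det])
    also have "\<dots> = (\<Sum>p | p permutes {0..<n}. signof p * (\<Prod>i = 0..<n. a (p i) i))"
      by (subst det_def'[of _ n]) (auto intro!: sum.cong prod.cong simp: permutes_in_image)
    also have "\<dots> = (\<Sum>p | p permutes {0..<n}. signof p * (\<Prod>x\<in>{1..n}. a (p (x - 1)) (x - 1)))"
      by (intro sum.cong refl arg_cong2[of _ _ _ _ "(*)"]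
            prod.reindex_bij_witness[where i = "\<lambda>x. x - 1" and j = Suc]) auto
    finally show ?thesis .
  qed
  show ?thesis
    unfolding expand
  proof (intro has_sum_sum has_sum_cmult_right)
    fix p assume "p \<in> {p. p permutes {0..<n}}"
    then have p: "p i < n" if "i < n" for i
      using that permutes_in_image[of p "{0..<n}" i] by simp
    have "((\<lambda>h. \<Prod>x\<in>{1..n}. f (p (x - 1)) (x - 1) (h x)) has_sum
        (\<Prod>x\<in>{1..n}. g (p (x - 1)) (x - 1))) (PiE {1..n} B)"
    proof (rule has_sum_prod_PiE_nonneg)
      fix x assume "x \<in> {1..n}"
      then have x: "x - 1 < n" "Suc (x - 1) = x" by auto
      then show "(f (p (x - 1)) (x - 1) has_sum g (p (x - 1)) (x - 1)) (B x)"
        using assms(1)[OF p x(1)] by simp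
      show "0 \<le> f (p (x - 1)) (x - 1) y" for y
        using assms(2) p x by simp
    qed simp
    also have "?this \<longleftrightarrow> ((\<lambda>h. \<Prod>x\<in>{1..n}. f (p (x - 1)) (x - 1) (h (Suc (x - 1)))) has_sum
        (\<Prod>x\<in>{1..n}. g (p (x - 1)) (x - 1))) (PiE {1..n} B)"
      by (intro has_sum_cong prod.cong) auto
    finally show "((\<lambda>h. \<Prod>x\<in>{1..n}. f (p (x - 1)) (x - 1) (h (Suc (x - 1)))) has_sum
        (\<Prod>x\<in>{1..n}. g (p (x - 1)) (x - 1))) (PiE {1..n} B)" .
  qed (simp add: finite_permutations)
qed

section \<open>Column operations on determinants and the Vandermonde determinant\<close>

lemma det_scale_rows_cols:
  fixes f :: "nat \<Rightarrow> nat \<Rightarrow> 'a::comm_ring_1"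
  shows "det (mat n n (\<lambda>(i, j). r i * c j * f i j))
       = (\<Prod>i<n. r i) * (\<Prod>j<n. c j) * det (mat n n (\<lambda>(i, j). f i j))"
proof -
  have "(\<Prod>i = 0..<n. r i * c (p i) * f i (p i))
      = (\<Prod>i<n. r i) * (\<Prod>j<n. c j) * (\<Prod>i = 0..<n. f i (p i))"
    if "p permutes {0..<n}" for p
    using prod.permute[OF that, of c] by (simp add: prod.distrib lessThan_atLeast0)
  then show ?thesis
    by (subst (1 2) det_def'[of _ n])
       (auto simp: sum_distrib_left permutes_in_image algebra_simps intro!: sum.cong)
qed

text \<open>All the column operations happen at once, as right multiplication by a unit upper
  bidiagonal matrix. Hence each column loses a multiple of the original preceding column, not of one
  already modified.\<close>

lemma det_sub_mult_pred_col:
  fixes f :: "nat \<Rightarrow> nat \<Rightarrow> 'a::comm_ring_1"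
  shows "det (mat n n (\<lambda>(i, j). f i j - (if j = 0 then 0 else c j * f i (j - 1))))
       = det (mat n n (\<lambda>(i, j). f i j))"
proof -
  define U where "U = mat n n (\<lambda>(k, j). if k = j then 1 else if Suc k = j then - c j else 0)"
  have "det U = 1"
    by (subst det_upper_triangular[of _ n])
       (auto simp: U_def prod_list_diag_prod intro!: upper_triangularI)
  moreover have "mat n n (\<lambda>(i, j). f i j - (if j = 0 then 0 else c j * f i (j - 1)))
      = mat n n (\<lambda>(i, j). f i j) * U"
  proof (rule eq_matI, goal_cases)
    case (1 i j)
    then have ij: "i < n" "j < n"
      by (simp_all add: U_def)
    then have "(mat n n (\<lambda>(i, j). f i j) * U) $$ (i, j)
        = (\<Sum>k = 0..<n. f i k * (if k = j then 1 else if Suc k = j then - c j else 0))"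
      by (simp add: U_def scalar_prod_def)
    also have "\<dots> = (\<Sum>k = 0..<n. (if k = j then f i k else 0)
        + (if Suc k = j then - c j * f i k else 0))"
      by (intro sum.cong) auto
    also have "\<dots> = f i j - (if j = 0 then 0 else c j * f i (j - 1))"
      using ij by (cases j) (auto simp: sum.distrib)
    finally show ?case
      using ij by (simp add: U_def)
  qed (auto simp: U_def)
  ultimately show ?thesis
    by (simp add: det_mult[of _ n] U_def)
qed

text \<open>The mirror image, with a unit lower bidiagonal matrix; the last column has no successor
  and stays as it is.\<close>

lemma det_sub_mult_succ_col:
  fixes f :: "nat \<Rightarrow> nat \<Rightarrow> 'a::idom"
  shows "det (mat n n (\<lambda>(i, j). f i j - (if Suc j < n then c j * f i (Suc j) else 0)))
       = det (mat n n (\<lambda>(i, j). f i j))"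
proof -
  define L where "L = mat n n (\<lambda>(k, j). if k = j then 1 else if k = Suc j then - c j else 0)"
  have "det L = 1"
    by (subst det_lower_triangular[of n])
       (auto simp: L_def prod_list_diag_prod)
  moreover have "mat n n (\<lambda>(i, j). f i j - (if Suc j < n then c j * f i (Suc j) else 0))
      = mat n n (\<lambda>(i, j). f i j) * L"
  proof (rule eq_matI, goal_cases)
    case (1 i j)
    then have ij: "i < n" "j < n"
      by (simp_all add: L_def)
    then have "(mat n n (\<lambda>(i, j). f i j) * L) $$ (i, j)
        = (\<Sum>k = 0..<n. f i k * (if k = j then 1 else if k = Suc j then - c j else 0))"
      by (simp add: L_def scalar_prod_def)
    also have "\<dots> = (\<Sum>k = 0..<n. (if k = j then f i k else 0)
        + (if k = Suc j then - c j * f i k else 0))"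
      by (intro sum.cong) auto
    also have "\<dots> = f i j - (if Suc j < n then c j * f i (Suc j) else 0)"
      using ij by (auto simp: sum.distrib)
    finally show ?case
      using ij by (simp add: L_def)
  qed (auto simp: L_def)
  ultimately show ?thesis
    by (simp add: det_mult[of _ n] L_def)
qed

lemma det_last_row_unit:
  fixes f :: "nat \<Rightarrow> nat \<Rightarrow> 'a::idom"
  assumes "\<And>j. j < n \<Longrightarrow> f n j = 0" and "f n n = 1"
  shows "det (mat (Suc n) (Suc n) (\<lambda>(i, j). f i j)) = det (mat n n (\<lambda>(i, j). f i j))"
proof -
  have "mat (Suc n) (Suc n) (\<lambda>(i, j). f i j)
      = four_block_mat (mat n n (\<lambda>(i, j). f i j)) (mat n 1 (\<lambda>(i, j). f i n)) (0\<^sub>m 1 n) (1\<^sub>m 1)"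
    using assms by (intro eq_matI) (auto simp: less_Suc_eq)
  then show ?thesis
    by (simp add: det_four_block_mat_lower_left_zero[of _ n _ 1])
qed

text \<open>Subtracting \<open>x n\<close> times the next column turns the last row into a unit
  vector and pulls the factor \<open>x i - x n\<close> out of every other row, leaving the
  determinant of size \<open>n\<close>.\<close>

lemma det_vandermonde:
  fixes x :: "nat \<Rightarrow> 'a::idom"
  shows "det (mat n n (\<lambda>(i, j). x i ^ (n - Suc j))) = (\<Prod>j<n. \<Prod>i<j. x i - x j)"
proof (induction n)
  case 0
  show ?case by simp
next
  case (Suc n)
  let ?f = "\<lambda>i j. x i ^ (Suc n - Suc j)"
  let ?g = "\<lambda>i j. ?f i j - (if Suc j < Suc n then x n * ?f i (Suc j) else 0)"
  have "det (mat (Suc n) (Suc n) (\<lambda>(i, j). ?f i j)) = det (mat (Suc n) (Suc n) (\<lambda>(i, j). ?g i j))"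
    by (rule det_sub_mult_succ_col[symmetric])
  also have "\<dots> = det (mat n n (\<lambda>(i, j). ?g i j))"
    by (rule det_last_row_unit) (auto simp: Suc_diff_Suc simp flip: power_Suc)
  also have "mat n n (\<lambda>(i, j). ?g i j) = mat n n (\<lambda>(i, j). (x i - x n) * 1 * x i ^ (n - Suc j))"
    by (intro eq_matI) (auto simp: algebra_simps Suc_diff_Suc simp flip: power_Suc)
  also have "det \<dots> = (\<Prod>i<n. x i - x n) * (\<Prod>j<n. \<Prod>i<j. x i - x j)"
    by (subst det_scale_rows_cols) (simp add: Suc)
  finally show ?case
    by (simp add: mult.commute)
qed

section \<open>Removing the outermost antidiagonal of a pattern\<close>

text \<open>
  Here \<open>n\<close> and \<open>lam\<close> belong to the smaller pattern, and \<open>s\<close> is the row shift: 0 when the last column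
  has been removed completely, 1 when every column has lost one entry.
\<close>

definition GT_peel ::
  "nat \<Rightarrow> nat \<Rightarrow> (nat \<Rightarrow> nat) \<Rightarrow> (int \<times> nat \<Rightarrow> nat) \<Rightarrow> (nat \<Rightarrow> nat) \<times> (int \<times> nat \<Rightarrow> nat)"
where
  "GT_peel s n lam T =
     ((\<lambda>i\<in>{1..n}. T (int i - int s, n + 1 - i)),
      (\<lambda>(i, j)\<in>GT_index n lam. T (i - int s, j)))"

text \<open>A reindexing along the bijection \<open>GT_peel\<close>; the removed antidiagonal
  contributes \<open>part_size n mu\<close> to the size. \<open>M\<close> is the interlacing
  condition: \<open>mu (i + 1) \<le> mu' i \<le> mu i\<close> for \<open>s = 0\<close> and
  \<open>mu i \<le> mu' i \<le> mu (i - 1)\<close> for \<open>s = 1\<close>. In the latter case the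
  guard \<open>s < i\<close> leaves \<open>mu' 1\<close> without an upper bound, so that
  \<open>mu 0\<close> is never read.\<close>

lemma GT_peel_has_sum:
  fixes q :: real and mu :: "nat \<Rightarrow> nat"
  assumes s: "s = 0 \<and> n = Suc n' \<and> lam n = 0 \<or> s = 1 \<and> n' = n \<and> (\<forall>j\<in>{1..n}. 1 \<le> lam j)"
    and lam': "lam' = (\<lambda>j. lam j - s)"
  defines "M \<equiv> PiE {1..n'} (\<lambda>i. {v. mu (i + 1 - s) \<le> v \<and> (s < i \<longrightarrow> v \<le> mu (i - s))})"
  shows "((\<lambda>T. q ^ GT_size n lam T) has_sum S) (GT n lam mu) \<longleftrightarrow>
    ((\<lambda>(mu', T'). q ^ part_size n mu * q ^ GT_size n' lam' T') has_sum S)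
      (SIGMA mu' : M. GT n' lam' mu')"
proof -
  define I where "I = GT_index n lam"
  define I' where "I' = GT_index n' lam'"
  define D where "D = (\<lambda>i. (int i, n + 1 - i)) ` {1..n}"
  have n': "n' + 1 = n + s" and s01: "s \<le> 1"
    using s by auto
  \<comment> \<open>The geometric core: the index set is its antidiagonal together with the smaller
    index set moved by \<open>s\<close> rows. For \<open>s = 0\<close> column \<open>n\<close>
    consists of its antidiagonal entry alone.\<close>
  have idx: "(i, j) \<in> I \<longleftrightarrow> (1 \<le> j \<and> j \<le> n \<and> i + int j = int n + 1) \<or> (i + int s, j) \<in> I'" for i j
    using s
  proof (elim disjE conjE)
    assume "s = 0" "n = Suc n'" "lam n = 0"
    then show ?thesis
      by (cases "j = n") (auto simp: I_def I'_def GT_index_def lam')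
  next
    assume "s = 1" "n' = n" "\<forall>j\<in>{1..n}. 1 \<le> lam j"
    moreover from this have "int (lam j - Suc 0) = int (lam j) - 1" if "1 \<le> j" "j \<le> n"
      using that by (simp add: of_nat_diff)
    ultimately show ?thesis
      by (auto simp: I_def I'_def GT_index_def lam')
  qed
  have I'D: "i + int j \<le> int n' + 1 \<and> 1 \<le> j \<and> j \<le> n'" if "(i, j) \<in> I'" for i j
    using that by (auto simp: I'_def GT_index_def)
  have I'_diag: "(int i, n' + 1 - i) \<in> I'" if "i \<in> {1..n'}" for i
    using that by (auto simp: I'_def GT_index_def)
  have fin: "finite I" "finite I'"
    by (simp_all add: I_def I'_def finite_GT_index)
  \<comment> \<open>The inverse of peeling. Outside the shifted smaller index set only antidiagonal
    positions remain; their row numbers are positive, so \<open>nat i\<close> loses nothing.\<close>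
  define glue where "glue = (\<lambda>(mu' :: nat \<Rightarrow> nat, T' :: int \<times> nat \<Rightarrow> nat).
    \<lambda>(i, j)\<in>I. if (i + int s, j) \<in> I' then T' (i + int s, j) else mu (nat i))"
  show ?thesis
  proof (rule has_sum_reindex_bij_witness[symmetric, where j = glue and i = "GT_peel s n' lam'"])
    fix p assume "p \<in> (SIGMA mu' : M. GT n' lam' mu')"
    then obtain mu' T' where p: "p = (mu', T')" and mu': "mu' \<in> M" and T': "T' \<in> GT n' lam' mu'"
      by auto
    have T'_ext: "T' \<in> extensional I'"
      using T' by (auto simp: GT_def I'_def PiE_iff)
    have T'_diag: "T' (int i, n' + 1 - i) = mu' i" if "i \<in> {1..n'}" for i
      using T' that by (auto simp: GT_def)
    have glue: "glue p (i, j) = (if (i + int s, j) \<in> I' then T' (i + int s, j) else mu (nat i))"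
      if "(i, j) \<in> I" for i j
      using that by (simp add: glue_def p)
    have glue': "glue p (i - int s, j) = T' (i, j)" if "(i, j) \<in> I'" for i j
      using that by (subst glue) (auto simp: idx)
    have "GT_peel s n' lam' (glue p) = (mu', T')"
      unfolding GT_peel_def prod.inject
    proof (intro conjI ext)
      fix i
      show "(\<lambda>i\<in>{1..n'}. glue p (int i - int s, n' + 1 - i)) i = mu' i"
        using glue'[OF I'_diag] T'_diag mu' by (auto simp: M_def PiE_iff extensional_def)
    next
      fix r :: "int \<times> nat"
      obtain i j where "r = (i, j)" by force
      then show "(\<lambda>(i, j)\<in>GT_index n' lam'. glue p (i - int s, j)) r = T' r"
        using glue' T'_ext by (auto simp: I'_def extensional_def)
    qed
    then show "GT_peel s n' lam' (glue p) = p"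
      by (simp add: p)
    show "glue p \<in> GT n lam mu"
      unfolding GT_def mem_Collect_eq I_def[symmetric]
    proof (intro conjI allI impI ballI)
      show "glue p \<in> I \<rightarrow>\<^sub>E UNIV"
        by (auto simp: glue_def p split_def)
    next
      fix i j assume ij: "(i, j) \<in> I \<and> (i, j + 1) \<in> I"
      show "glue p (i, j) \<le> glue p (i, j + 1)"
      proof (cases "(i + int s, j + 1) \<in> I'")
        case True
        then have "(i + int s, j) \<in> I'"
          using ij n' idx[of i j] I'D[OF True] by auto
        with True show ?thesis
          using ij T' by (auto simp: glue GT_def I'_def)
      next
        case False
        then have j: "i + int j = int n" "j + 1 \<le> n" "1 \<le> j"
          using ij idx[of i "j + 1"] idx[of i j] I'D[of "i + int s" j] by auto
        \<comment> \<open>Here \<open>(i, j + 1)\<close> lies on the removed antidiagonal and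
          \<open>(i, j)\<close> on the next one, as entry number \<open>k\<close> of
          \<open>mu'\<close>. The inequality wanted is the upper bound in \<open>M\<close>.\<close>
        define k where "k = nat i + s"
        have k: "k \<in> {1..n'}" "s < k" "j = n' + 1 - k" "i + int s = int k" "k - s = nat i"
          using j n' by (auto simp: k_def)
        have "(i + int s, j) \<in> I'"
          using ij idx[of i j] j by auto
        moreover have "mu' k \<le> mu (nat i)"
          using mu' k unfolding M_def by (auto dest!: PiE_mem[of _ _ _ k])
        ultimately show ?thesis
          using ij False T'_diag[OF k(1)] k by (simp add: glue)
      qed
    next
      fix i j assume ij: "(i, j) \<in> I \<and> (i + 1, j) \<in> I"
      show "glue p (i + 1, j) \<le> glue p (i, j)"
      proof (cases "(i + 1 + int s, j) \<in> I'")
        case True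
        then have "(i + int s, j) \<in> I'"
          using ij n' idx[of i j] I'D[OF True] by auto
        moreover have "(i + int s, j) \<in> I' \<and> (i + int s + 1, j) \<in> I'
            \<Longrightarrow> T' (i + int s + 1, j) \<le> T' (i + int s, j)"
          using T' unfolding GT_def I'_def by blast
        ultimately show ?thesis
          using ij True by (simp add: glue algebra_simps)
      next
        case False
        then have j: "i + int j = int n" "1 \<le> j" "j \<le> n"
          using ij idx[of "i + 1" j] by auto
        have I': "(i + int s, j) \<in> I'"
          using ij idx[of i j] j by auto
        \<comment> \<open>Now \<open>(i + 1, j)\<close> lies on the removed antidiagonal, and the
          inequality is the lower bound in \<open>M\<close>.\<close>
        define k where "k = nat (i + int s)"
        have k: "k \<in> {1..n'}" "j = n' + 1 - k" "i + int s = int k" "k + 1 - s = nat (i + 1)"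
          using j n' I'D[OF I'] by (auto simp: k_def)
        have "mu (nat (i + 1)) \<le> mu' k"
          using mu' k unfolding M_def by (auto dest!: PiE_mem[of _ _ _ k])
        then show ?thesis
          using ij False I' T'_diag[OF k(1)] k by (simp add: glue)
      qed
    next
      fix i assume "i \<in> {1..n}"
      then show "glue p (int i, n + 1 - i) = mu i"
        using n' I'D[of "int i + int s" "n + 1 - i"] by (subst glue) (auto simp: idx)
    qed
    have I_split: "I = D \<union> (\<lambda>(i, j). (i - int s, j)) ` I'"
    proof (intro Set.set_eqI)
      fix r :: "int \<times> nat"
      obtain i j where r: "r = (i, j)" by force
      have "(i, j) \<in> D \<longleftrightarrow> 1 \<le> j \<and> j \<le> n \<and> i + int j = int n + 1"
        by (auto simp: D_def image_iff intro!: bexI[of _ "nat i"])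
      moreover have "(i, j) \<in> (\<lambda>(i, j). (i - int s, j)) ` I' \<longleftrightarrow> (i + int s, j) \<in> I'"
        by (force simp: image_iff)
      ultimately show "r \<in> I \<longleftrightarrow> r \<in> D \<union> (\<lambda>(i, j). (i - int s, j)) ` I'"
        by (simp add: r idx)
    qed
    have "D \<inter> (\<lambda>(i, j). (i - int s, j)) ` I' = {}"
    proof (rule equals0I)
      fix r assume "r \<in> D \<inter> (\<lambda>(i, j). (i - int s, j)) ` I'"
      then obtain i j where "r = (i - int s, j)" "(i, j) \<in> I'" "r \<in> D"
        by auto
      then show False
        using I'D[of i j] n' by (auto simp: D_def)
    qed
    then have "GT_size n lam (glue p) = (\<Sum>r\<in>D. glue p r) + (\<Sum>r\<in>(\<lambda>(i, j). (i - int s, j)) ` I'. glue p r)"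
      unfolding GT_size_def I_def[symmetric] I_split
      using fin by (intro sum.union_disjoint) (simp_all add: D_def)
    also have "(\<Sum>r\<in>D. glue p r) = part_size n mu"
      unfolding D_def part_size_def
    proof (subst sum.reindex)
      show "inj_on (\<lambda>i. (int i, n + 1 - i)) {1..n}"
        by (auto simp: inj_on_def)
      show "sum (glue p \<circ> (\<lambda>i. (int i, n + 1 - i))) {1..n} = sum mu {1..n}"
        using \<open>glue p \<in> GT n lam mu\<close> by (intro sum.cong) (auto simp: GT_def)
    qed
    also have "(\<Sum>r\<in>(\<lambda>(i, j). (i - int s, j)) ` I'. glue p r) = GT_size n' lam' T'"
      unfolding GT_size_def I'_def[symmetric]
      using glue' by (subst sum.reindex) (auto simp: inj_on_def intro!: sum.cong)
    finally show "q ^ GT_size n lam (glue p)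
        = (\<lambda>(mu', T'). q ^ part_size n mu * q ^ GT_size n' lam' T') p"
      by (simp add: p power_add)
  next
    fix T assume T: "T \<in> GT n lam mu"
    have T_ext: "T \<in> extensional I"
      using T by (auto simp: GT_def I_def PiE_iff)
    have T_diag: "T (int i, n + 1 - i) = mu i" if "i \<in> {1..n}" for i
      using T that by (auto simp: GT_def)
    have T_right: "T (i, j) \<le> T (i, j + 1)" if "(i, j) \<in> I" "(i, j + 1) \<in> I" for i j
      using T that by (auto simp: GT_def I_def)
    have T_down: "T (i + 1, j) \<le> T (i, j)" if "(i, j) \<in> I" "(i + 1, j) \<in> I" for i j
      using T that by (auto simp: GT_def I_def)
    show "glue (GT_peel s n' lam' T) = T"
    proof (rule ext)
      fix r :: "int \<times> nat"
      obtain i j where r: "r = (i, j)" by force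
      show "glue (GT_peel s n' lam' T) r = T r"
      proof (cases "(i, j) \<in> I \<and> (i + int s, j) \<notin> I'")
        case True
        then have "1 \<le> j" "j \<le> n" "i + int j = int n + 1"
          using idx by auto
        then have "int (nat i) = i" "n + 1 - nat i = j" "nat i \<in> {1..n}"
          by auto
        then show ?thesis
          using True T_diag[of "nat i"] by (simp add: glue_def GT_peel_def r)
      qed (use T_ext in \<open>auto simp: glue_def GT_peel_def r I'_def extensional_def\<close>)
    qed
    let ?mu' = "\<lambda>i\<in>{1..n'}. T (int i - int s, n' + 1 - i)"
    let ?T' = "\<lambda>(i, j)\<in>GT_index n' lam'. T (i - int s, j)"
    have "?mu' \<in> M"
      unfolding M_def restrict_PiE_iff mem_Collect_eq
    proof (intro ballI conjI impI)
      fix i assume i: "i \<in> {1..n'}"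
      have left: "(int i - int s, n' + 1 - i) \<in> I"
        using I'_diag[OF i] by (simp add: idx)
      have *: "i + 1 - s \<in> {1..n}" "n + 1 - (i + 1 - s) = n' + 1 - i"
          "int (i + 1 - s) = int i - int s + 1"
        using i n' s01 by auto
      then have "(int i - int s + 1, n' + 1 - i) \<in> I"
        using n' i by (auto simp: idx)
      with T_down[OF left] T_diag[OF *(1)] show "mu (i + 1 - s) \<le> T (int i - int s, n' + 1 - i)"
        by (simp only: *)
      assume "s < i"
      then have *: "i - s \<in> {1..n}" "n + 1 - (i - s) = n' + 1 - i + 1" "int (i - s) = int i - int s"
        using i n' by auto
      then have "(int i - int s, n' + 1 - i + 1) \<in> I"
        using n' i by (auto simp: idx)
      with T_right[OF left] T_diag[OF *(1)] show "T (int i - int s, n' + 1 - i) \<le> mu (i - s)"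
        by (simp only: *)
    qed
    moreover have "?T' \<in> GT n' lam' ?mu'"
      unfolding GT_def mem_Collect_eq I'_def[symmetric]
    proof (intro conjI allI impI ballI)
      fix i j assume "(i, j) \<in> I' \<and> (i, j + 1) \<in> I'"
      then show "(\<lambda>(i, j)\<in>I'. T (i - int s, j)) (i, j) \<le> (\<lambda>(i, j)\<in>I'. T (i - int s, j)) (i, j + 1)"
        using T_right[of "i - int s" j] by (simp add: idx)
    next
      fix i j assume "(i, j) \<in> I' \<and> (i + 1, j) \<in> I'"
      then show "(\<lambda>(i, j)\<in>I'. T (i - int s, j)) (i + 1, j) \<le> (\<lambda>(i, j)\<in>I'. T (i - int s, j)) (i, j)"
        using T_down[of "i - int s" j] by (simp add: idx algebra_simps)
    next
      fix i assume "i \<in> {1..n'}"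
      then show "(\<lambda>(i, j)\<in>I'. T (i - int s, j)) (int i, n' + 1 - i)
          = (\<lambda>i\<in>{1..n'}. T (int i - int s, n' + 1 - i)) i"
        using I'_diag by simp
    qed auto
    ultimately show "GT_peel s n' lam' T \<in> (SIGMA mu' : M. GT n' lam' mu')"
      by (simp add: GT_peel_def)
  qed simp
qed

section \<open>The closed form and its two one-step recursions\<close>

text \<open>The second form of the claimed value, with \<open>schur\<close> times
  \<open>Delta_bar\<close> replaced by the alternant, which it equals up to the sign. No denominator
  depends on \<open>mu\<close>, so this form can be summed over \<open>mu\<close>.\<close>

definition GT_value :: "real \<Rightarrow> nat \<Rightarrow> (nat \<Rightarrow> nat) \<Rightarrow> (nat \<Rightarrow> nat) \<Rightarrow> real" where
  "GT_value q n lam mu =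
     (- 1) ^ (n choose 2) * q ^ part_size n mu
     * det (mat n n (\<lambda>(i, j). q ^ ((lam (Suc i) + \<delta> n (Suc i)) * (mu (Suc j) + \<delta> n (Suc j)))))
     / (q ^ b_stat n (\<lambda>i. \<delta> n i + lam i) * (\<Prod>j = 1..n. qq_poch q (lam j + \<delta> n j)))"

lemma sum_lessThan_choose_two: "(\<Sum>i<n. i) = n choose 2"
  by (induction n) (simp_all add: numeral_2_eq_2)

lemma sum_staircase: "(\<Sum>j<n. \<delta> n (Suc j)) = n choose 2"
  by (simp add: \<delta>_def sum.nat_diff_reindex[of "\<lambda>i. i"] sum_lessThan_choose_two)

lemma Suc_choose_two: "Suc n choose 2 = n + (n choose 2)"
  by (simp add: numeral_2_eq_2)

lemma qq_poch_Suc: "qq_poch q (Suc k) = qq_poch q k * (1 - q ^ Suc k)"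
  by (simp add: qq_poch_def)

lemma qq_poch_pos:
  fixes q :: real
  assumes "0 < q" "q < 1"
  shows "0 < qq_poch q k"
  unfolding qq_poch_def using assms by (intro prod_pos) (auto simp: power_less_one_iff)

lemma has_sum_geometric_atLeast:
  fixes x :: real
  assumes "0 \<le> x" "x < 1"
  shows "((\<lambda>v. x ^ (v + d)) has_sum x ^ (a + d) / (1 - x)) {a..}"
proof -
  have "((\<lambda>k. x ^ k) has_sum 1 / (1 - x)) UNIV"
    using assms by (intro norm_summable_imp_has_sum geometric_sums) (auto intro: summable_geometric)
  then have "((\<lambda>k. x ^ (a + d) * x ^ k) has_sum x ^ (a + d) * (1 / (1 - x))) UNIV"
    by (rule has_sum_cmult_right)
  also have "?this \<longleftrightarrow> ?thesis"
    by (rule has_sum_reindex_bij_witness[where i = "\<lambda>v. v - a" and j = "\<lambda>k. k + a"])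
       (auto simp: power_add)
  finally show ?thesis .
qed

lemma has_sum_geometric_atLeastAtMost:
  fixes x :: real
  assumes "x \<noteq> 1" "a \<le> Suc b"
  shows "((\<lambda>v. x ^ (v + d)) has_sum (x ^ (a + d) - x ^ (Suc b + d)) / (1 - x)) {a..b}"
proof (rule has_sum_finiteI)
  have "(\<Sum>v=a..b. x ^ (v + d)) = x ^ d * (\<Sum>v=a..b. x ^ v)"
    by (simp add: sum_distrib_left power_add mult.commute)
  also have "(\<Sum>v=a..b. x ^ v) = (x ^ a - x ^ Suc b) / (1 - x)"
  proof (cases "a \<le> b")
    case False
    with assms(2) have "a = Suc b" by simp
    then show ?thesis by simp
  qed (use assms(1) in \<open>simp add: sum_gp\<close>)
  finally show "(x ^ (a + d) - x ^ (Suc b + d)) / (1 - x) = (\<Sum>v=a..b. x ^ (v + d))"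
    by (simp add: power_add algebra_simps diff_divide_distrib)
qed simp

text \<open>The computation common to both ways of peeling. \<open>u k j\<close> is the numerator of
  the geometric sum of ratio \<open>q ^ k\<close> over the range of the entry \<open>Suc j\<close>;
  the two applications differ only in these ranges.\<close>

lemma GT_value_has_sum:
  fixes q :: real
  assumes q: "0 < q" "q < 1"
    and u: "\<And>j k. j < n \<Longrightarrow> 1 \<le> k \<Longrightarrow>
      ((\<lambda>v. (q ^ k) ^ (v + \<delta> n (Suc j))) has_sum u k j / (1 - q ^ k)) (S (Suc j))"
  shows "(GT_value q n lam has_sum
      (- 1) ^ (n choose 2) * det (mat n n (\<lambda>(i, j). u (Suc (lam (Suc i) + \<delta> n (Suc i))) j))
      / (q ^ (b_stat n (\<lambda>i. \<delta> n i + lam i) + (n choose 2))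
         * (\<Prod>j = 1..n. qq_poch q (Suc (lam j + \<delta> n j)))))
    (PiE {1..n} S)"
proof -
  define l where "l i = lam (Suc i) + \<delta> n (Suc i)" for i
  define d where "d j = \<delta> n (Suc j)" for j
  define C where "C = (- 1) ^ (n choose 2)
    / (q ^ b_stat n (\<lambda>i. \<delta> n i + lam i) * (\<Prod>j = 1..n. qq_poch q (lam j + \<delta> n j)))"
  \<comment> \<open>Absorbing \<open>q ^ part_size n mu\<close> into the columns raises every
    \<open>l i\<close> by one, at the price of the factor \<open>q ^ d j\<close> in column
    \<open>j\<close>.\<close>
  let ?f = "\<lambda>i j v. (q ^ Suc (l i)) ^ (v + d j) / q ^ d j"
  have "((\<lambda>mu. det (mat n n (\<lambda>(i, j). ?f i j (mu (Suc j))))) has_sum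
      det (mat n n (\<lambda>(i, j). u (Suc (l i)) j / (1 - q ^ Suc (l i)) / q ^ d j))) (PiE {1..n} S)"
    using q u[where k = "Suc (l _)"]
    by (intro has_sum_det_PiE has_sum_divide_const) (auto simp: d_def)
  then have "((\<lambda>mu. C * det (mat n n (\<lambda>(i, j). ?f i j (mu (Suc j))))) has_sum
      C * det (mat n n (\<lambda>(i, j). u (Suc (l i)) j / (1 - q ^ Suc (l i)) / q ^ d j))) (PiE {1..n} S)"
    by (rule has_sum_cmult_right)
  moreover have "C * det (mat n n (\<lambda>(i, j). ?f i j (mu (Suc j)))) = GT_value q n lam mu" for mu
  proof -
    have "?f i j v = 1 * q ^ v * q ^ (l i * (v + d j))" for i j v
      using q by (simp add: power_add algebra_simps flip: power_mult)
    then have "det (mat n n (\<lambda>(i, j). ?f i j (mu (Suc j))))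
        = det (mat n n (\<lambda>(i, j). 1 * q ^ mu (Suc j) * q ^ (l i * (mu (Suc j) + d j))))"
      by simp
    also have "\<dots> = (\<Prod>j<n. q ^ mu (Suc j)) * det (mat n n (\<lambda>(i, j). q ^ (l i * (mu (Suc j) + d j))))"
      by (subst det_scale_rows_cols) simp
    also have "(\<Prod>j<n. q ^ mu (Suc j)) = q ^ part_size n mu"
      by (simp add: part_size_def sum.atLeast1_atMost_eq power_sum)
    finally show ?thesis
      by (simp add: GT_value_def C_def l_def d_def)
  qed
  \<comment> \<open>The row factors extend each \<open>qq_poch\<close> by one term, and the column
    factors collect to the power \<open>n choose 2\<close>.\<close>
  moreover have "C * det (mat n n (\<lambda>(i, j). u (Suc (l i)) j / (1 - q ^ Suc (l i)) / q ^ d j))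
    = (- 1) ^ (n choose 2) * det (mat n n (\<lambda>(i, j). u (Suc (l i)) j))
      / (q ^ (b_stat n (\<lambda>i. \<delta> n i + lam i) + (n choose 2))
         * (\<Prod>j = 1..n. qq_poch q (Suc (lam j + \<delta> n j))))"
  proof -
    have inverse_prod: "(\<Prod>i<n. inverse (f i)) = inverse (\<Prod>i<n. f i)" for f :: "nat \<Rightarrow> real"
      using prod_inversef[of f] by (simp add: comp_def)
    have "det (mat n n (\<lambda>(i, j). u (Suc (l i)) j / (1 - q ^ Suc (l i)) / q ^ d j))
        = det (mat n n (\<lambda>(i, j). inverse (1 - q ^ Suc (l i)) * inverse (q ^ d j) * u (Suc (l i)) j))"
      by (simp add: field_simps)
    also have "\<dots> = (\<Prod>i<n. inverse (1 - q ^ Suc (l i))) * (\<Prod>j<n. inverse (q ^ d j))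
        * det (mat n n (\<lambda>(i, j). u (Suc (l i)) j))"
      by (rule det_scale_rows_cols)
    also have "(\<Prod>i<n. inverse (1 - q ^ Suc (l i))) = inverse (\<Prod>i<n. 1 - q ^ Suc (l i))"
      by (rule inverse_prod)
    also have "(\<Prod>j<n. inverse (q ^ d j)) = inverse (q ^ (n choose 2))"
      by (simp only: inverse_prod d_def power_sum[symmetric] sum_staircase)
    finally show ?thesis
      by (simp add: C_def l_def qq_poch_Suc prod.atLeast1_atMost_eq prod.distrib power_add
          divide_inverse mult_ac)
  qed
  ultimately show ?thesis
    by (simp add: l_def)
qed

text \<open>Passing from \<open>\<delta> n\<close> to \<open>\<delta> (Suc n)\<close> raises the
  first \<open>n\<close> exponents \<open>l i\<close> by one, just as the summation does. The new
  last exponent is 0, and the sign \<open>(- 1) ^ n\<close> from reversing the column differences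
  accounts for \<open>Suc n choose 2\<close>.\<close>

lemma GT_value_has_sum_shrink:
  fixes q :: real
  assumes q: "0 < q" "q < 1"
    and mu: "antimono_on {1..Suc n} mu"
    and lam: "lam (Suc n) = 0"
  shows "((\<lambda>mu'. q ^ part_size (Suc n) mu * GT_value q n lam mu') has_sum GT_value q (Suc n) lam mu)
    (PiE {1..n} (\<lambda>i. {mu (Suc i)..mu i}))"
proof -
  define y where "y j = mu (Suc j) + \<delta> (Suc n) (Suc j)" for j
  define l where "l i = lam (Suc i) + \<delta> (Suc n) (Suc i)" for i
  \<comment> \<open>The staircase makes the ranges fit: the first power beyond the upper end of
    range \<open>j\<close> has exponent \<open>k * y j\<close>, and the lower end gives
    \<open>k * y (Suc j)\<close>.\<close>
  define u where "u k j = (q ^ k) ^ y (Suc j) - (q ^ k) ^ y j" for k j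
  have l: "Suc (lam (Suc i) + \<delta> n (Suc i)) = l i" if "i < n" for i
    using that by (simp add: l_def \<delta>_def)
  have "((\<lambda>v. (q ^ k) ^ (v + \<delta> n (Suc j))) has_sum u k j / (1 - q ^ k)) {mu (Suc (Suc j))..mu (Suc j)}"
    if jk: "j < n" "1 \<le> k" for j k
  proof -
    have "q ^ k \<noteq> 1"
      using power_less_one_iff[of q k] q jk by auto
    moreover have "mu (Suc (Suc j)) \<le> Suc (mu (Suc j))"
      using monotone_onD[OF mu, of "Suc j" "Suc (Suc j)"] jk by simp
    ultimately have "((\<lambda>v. (q ^ k) ^ (v + \<delta> n (Suc j))) has_sum
        ((q ^ k) ^ (mu (Suc (Suc j)) + \<delta> n (Suc j)) - (q ^ k) ^ (Suc (mu (Suc j)) + \<delta> n (Suc j)))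
          / (1 - q ^ k)) {mu (Suc (Suc j))..mu (Suc j)}"
      by (rule has_sum_geometric_atLeastAtMost)
    moreover have "u k j = (q ^ k) ^ (mu (Suc (Suc j)) + \<delta> n (Suc j))
        - (q ^ k) ^ (Suc (mu (Suc j)) + \<delta> n (Suc j))"
      using jk by (simp add: u_def y_def \<delta>_def Suc_diff_Suc flip: add_Suc_right)
    ultimately show ?thesis
      by (simp only:)
  qed
  note * = GT_value_has_sum[OF q, where u = u and S = "\<lambda>i. {mu (Suc i)..mu i}" and lam = lam, OF this]
  have "det (mat (Suc n) (Suc n) (\<lambda>(i, j). (q ^ l i) ^ y j))
      = det (mat (Suc n) (Suc n) (\<lambda>(i, j). (q ^ l i) ^ y j
          - (if Suc j < Suc n then 1 * (q ^ l i) ^ y (Suc j) else 0)))"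
    by (rule det_sub_mult_succ_col[symmetric])
  \<comment> \<open>As \<open>l n = 0\<close>, the last row consisted of ones; after the subtraction
    it is a unit vector.\<close>
  also have "\<dots> = det (mat n n (\<lambda>(i, j). (q ^ l i) ^ y j
          - (if Suc j < Suc n then 1 * (q ^ l i) ^ y (Suc j) else 0)))"
    using lam by (intro det_last_row_unit) (auto simp: l_def \<delta>_def)
  also have "\<dots> = det (mat n n (\<lambda>(i, j). (- 1) * 1 * u (l i) j))"
    by (intro arg_cong[of _ _ det] eq_matI) (auto simp: u_def)
  also have "\<dots> = (- 1) ^ n * det (mat n n (\<lambda>(i, j). u (l i) j))"
    by (subst det_scale_rows_cols) simp
  finally have "det (mat (Suc n) (Suc n) (\<lambda>(i, j). q ^ (l i * y j)))
      = (- 1) ^ n * det (mat n n (\<lambda>(i, j). u (l i) j))"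
    by (simp add: power_mult)
  moreover have "det (mat n n (\<lambda>(i, j). u (Suc (lam (Suc i) + \<delta> n (Suc i))) j))
      = det (mat n n (\<lambda>(i, j). u (l i) j))"
    by (intro arg_cong[of _ _ det] eq_matI) (auto simp: l)
  \<comment> \<open>Raising the first \<open>n\<close> parts by one adds
    \<open>0 + ... + (n - 1)\<close> to the weighted sum, and the zero part at the end adds
    nothing.\<close>
  moreover have "b_stat n (\<lambda>i. \<delta> n i + lam i) + (n choose 2) = b_stat (Suc n) (\<lambda>i. \<delta> (Suc n) i + lam i)"
  proof -
    have "b_stat (Suc n) (\<lambda>i. \<delta> (Suc n) i + lam i) = (\<Sum>i<n. i * l i)"
      using lam by (simp add: b_stat_def sum.atLeast1_atMost_eq l_def \<delta>_def add.commute)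
    also have "\<dots> = (\<Sum>i<n. i * (lam (Suc i) + \<delta> n (Suc i)) + i)"
      by (intro sum.cong) (auto simp flip: l)
    finally show ?thesis
      by (simp add: b_stat_def sum.atLeast1_atMost_eq sum.distrib sum_lessThan_choose_two add.commute)
  qed
  moreover have "(\<Prod>j = 1..n. qq_poch q (Suc (lam j + \<delta> n j)))
      = (\<Prod>j = 1..Suc n. qq_poch q (lam j + \<delta> (Suc n) j))"
  proof -
    have "(\<Prod>j = 1..Suc n. qq_poch q (lam j + \<delta> (Suc n) j)) = (\<Prod>i<n. qq_poch q (l i))"
      using lam by (simp add: prod.atLeast1_atMost_eq l_def \<delta>_def qq_poch_def[of _ 0])
    then show ?thesis
      by (auto simp: prod.atLeast1_atMost_eq l intro!: prod.cong)
  qed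
  ultimately show ?thesis
    using has_sum_cmult_right[OF *, of "q ^ part_size (Suc n) mu"]
    by (simp add: GT_value_def l_def y_def Suc_choose_two power_add mult_ac flip: power_mult_distrib)
qed

text \<open>The size of the determinant is unchanged. Column 0 comes from an infinite geometric sum
  and has a single term; every other column is a difference with its predecessor, so no sign
  appears.\<close>

lemma GT_value_has_sum_lower:
  fixes q :: real
  assumes q: "0 < q" "q < 1"
    and mu: "antimono_on {1..n} mu"
    and lam: "\<And>j. j \<in> {1..n} \<Longrightarrow> 1 \<le> lam j"
  shows "((\<lambda>mu'. q ^ part_size n mu * GT_value q n (\<lambda>j. lam j - 1) mu') has_sum GT_value q n lam mu)
    (PiE {1..n} (\<lambda>i. {v. mu i \<le> v \<and> (1 < i \<longrightarrow> v \<le> mu (i - 1))}))"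
proof -
  define y where "y j = mu (Suc j) + \<delta> n (Suc j)" for j
  define l where "l i = lam (Suc i) + \<delta> n (Suc i)" for i
  define u where "u k j = (q ^ k) ^ y j - (if j = 0 then 0 else 1 * (q ^ k) ^ y (j - 1))" for k j
  define S where "S i = {v. mu i \<le> v \<and> (1 < i \<longrightarrow> v \<le> mu (i - 1))}" for i
  have l: "Suc (lam (Suc i) - 1 + \<delta> n (Suc i)) = l i" if "i < n" for i
    using lam[of "Suc i"] that by (simp add: l_def)
  have "((\<lambda>v. (q ^ k) ^ (v + \<delta> n (Suc j))) has_sum u k j / (1 - q ^ k)) (S (Suc j))"
    if jk: "j < n" "1 \<le> k" for j k
  proof (cases j)
    case 0
    then have "S (Suc j) = {mu (Suc j)..}"
      by (auto simp: S_def)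
    then show ?thesis
      using has_sum_geometric_atLeast[of "q ^ k"] q jk 0
      by (simp add: u_def y_def power_less_one_iff)
  next
    case (Suc j')
    have "q ^ k \<noteq> 1"
      using power_less_one_iff[of q k] q jk by auto
    moreover have "mu (Suc j) \<le> Suc (mu j)"
      using monotone_onD[OF mu, of j "Suc j"] jk Suc by simp
    ultimately have "((\<lambda>v. (q ^ k) ^ (v + \<delta> n (Suc j))) has_sum
        ((q ^ k) ^ (mu (Suc j) + \<delta> n (Suc j)) - (q ^ k) ^ (Suc (mu j) + \<delta> n (Suc j)))
          / (1 - q ^ k)) {mu (Suc j)..mu j}"
      by (intro has_sum_geometric_atLeastAtMost)
    moreover have "S (Suc j) = {mu (Suc j)..mu j}"
      using Suc by (auto simp: S_def)
    moreover have "u k j = (q ^ k) ^ (mu (Suc j) + \<delta> n (Suc j)) - (q ^ k) ^ (Suc (mu j) + \<delta> n (Suc j))"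
      using jk Suc by (simp add: u_def y_def \<delta>_def Suc_diff_Suc flip: add_Suc_right)
    ultimately show ?thesis
      by (simp only:)
  qed
  note * = GT_value_has_sum[OF q, where u = u and S = S and lam = "\<lambda>j. lam j - 1", OF this]
  have "det (mat n n (\<lambda>(i, j). u (l i) j)) = det (mat n n (\<lambda>(i, j). (q ^ l i) ^ y j))"
    unfolding u_def by (rule det_sub_mult_pred_col)
  moreover have "det (mat n n (\<lambda>(i, j). u (Suc (lam (Suc i) - 1 + \<delta> n (Suc i))) j))
      = det (mat n n (\<lambda>(i, j). u (l i) j))"
    by (intro arg_cong[of _ _ det] eq_matI) (auto simp del: One_nat_def simp: l)
  moreover have "b_stat n (\<lambda>i. \<delta> n i + (lam i - 1)) + (n choose 2) = b_stat n (\<lambda>i. \<delta> n i + lam i)"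
  proof -
    have "b_stat n (\<lambda>i. \<delta> n i + lam i) = (\<Sum>i<n. i * l i)"
      by (simp add: b_stat_def sum.atLeast1_atMost_eq l_def add.commute)
    also have "\<dots> = (\<Sum>i<n. i * (lam (Suc i) - 1 + \<delta> n (Suc i)) + i)"
      by (intro sum.cong) (auto simp flip: l)
    finally show ?thesis
      by (simp add: b_stat_def sum.atLeast1_atMost_eq sum.distrib sum_lessThan_choose_two add.commute)
  qed
  moreover have "(\<Prod>j = 1..n. qq_poch q (Suc (lam j - 1 + \<delta> n j)))
      = (\<Prod>j = 1..n. qq_poch q (lam j + \<delta> n j))"
  proof (intro prod.cong refl)
    fix j assume "j \<in> {1..n}"
    then show "qq_poch q (Suc (lam j - 1 + \<delta> n j)) = qq_poch q (lam j + \<delta> n j)"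
      using lam[of j] by simp
  qed
  ultimately show ?thesis
    using has_sum_cmult_right[OF *, of "q ^ part_size n mu"]
    unfolding S_def
    by (simp add: GT_value_def l_def y_def mult_ac flip: power_mult)
qed

section \<open>Induction over patterns\<close>

text \<open>Removing column \<open>n\<close> lowers \<open>n\<close>, and shortening all columns
  lowers the sum of \<open>lam\<close>. Monotonicity is asked on \<open>{1..n}\<close> because a
  peeled \<open>mu'\<close> is \<open>undefined\<close> beyond \<open>n'\<close>.\<close>

lemma GT_has_sum:
  fixes q :: real
  assumes q: "0 < q" "q < 1"
    and "antimono_on {1..n} lam" "antimono_on {1..n} mu"
  shows "((\<lambda>T. q ^ GT_size n lam T) has_sum GT_value q n lam mu) (GT n lam mu)"
  using assms(3,4)
proof (induction "n + (\<Sum>i = 1..n. lam i)" arbitrary: n lam mu rule: less_induct)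
  case less
  note lam = monotone_onD[OF less.prems(1)] and mu = monotone_onD[OF less.prems(2)]
  show ?case
  proof (cases "n = 0")
    case True
    then have "GT_index n lam = {}"
      by (auto simp: GT_index_def)
    with True show ?thesis
      by (simp add: GT_def GT_size_def GT_value_def part_size_def b_stat_def
          has_sum_finite_iff numeral_2_eq_2)
  next
    case False
    define s n' where "s = (if lam n = 0 then 0 else 1 :: nat)" and "n' = n + s - 1"
    define lam' where "lam' = (\<lambda>j. lam j - s)"
    define M where "M = PiE {1..n'} (\<lambda>i. {v. mu (i + 1 - s) \<le> v \<and> (s < i \<longrightarrow> v \<le> mu (i - s))})"
    have lam_pos: "1 \<le> lam j" if "lam n \<noteq> 0" "j \<in> {1..n}" for j
      using lam[of j n] that by simp
    have s: "s = 0 \<and> n = Suc n' \<and> lam n = 0 \<or> s = 1 \<and> n' = n \<and> (\<forall>j\<in>{1..n}. 1 \<le> lam j)"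
    proof (cases "lam n = 0")
      case True
      with False show ?thesis by (simp add: s_def n'_def)
    next
      case False
      then have "\<forall>j\<in>{1..n}. 1 \<le> lam j"
        using lam_pos by blast
      with False show ?thesis by (simp add: s_def n'_def)
    qed
    have smaller: "n' + (\<Sum>i = 1..n'. lam' i) < n + (\<Sum>i = 1..n. lam i)"
      using s
    proof (elim disjE conjE)
      assume *: "s = 1" "n' = n" "\<forall>j\<in>{1..n}. 1 \<le> lam j"
      have "(\<Sum>i = 1..n. lam i - 1) < (\<Sum>i = 1..n. lam i)"
      proof (rule sum_strict_mono)
        show "lam i - 1 < lam i" if "i \<in> {1..n}" for i
          using *(3) that by force
      qed (use False in auto)
      with * show ?thesis
        by (simp add: lam'_def)
    qed (simp add: lam'_def)
    have lam': "antimono_on {1..n'} lam'"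
    proof (rule monotone_onI)
      fix i j assume "i \<in> {1..n'}" "j \<in> {1..n'}" "i \<le> j"
      then show "lam' j \<le> lam' i"
        using s unfolding lam'_def by (intro diff_le_mono lam) auto
    qed
    have IH: "((\<lambda>T. q ^ GT_size n' lam' T) has_sum GT_value q n' lam' mu') (GT n' lam' mu')"
      if "mu' \<in> M" for mu'
    proof (rule less.hyps[OF smaller lam'], rule monotone_onI)
      fix i j assume ij: "i \<in> {1..n'}" "j \<in> {1..n'}" "i \<le> j"
      show "mu' j \<le> mu' i"
      proof (cases "i = j")
        case False
        \<comment> \<open>Interlacing gives the chain
          \<open>mu' j \<le> mu (j - s) \<le> mu (i + 1 - s) \<le> mu' i\<close>; the first bound is
          available since \<open>s \<le> 1 \<le> i < j\<close>.\<close>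
        have "mu' j \<le> mu (j - s)" "mu (i + 1 - s) \<le> mu' i"
          using PiE_mem[OF that[unfolded M_def]] ij False s by auto
        moreover have "mu (j - s) \<le> mu (i + 1 - s)"
          using ij False s by (intro mu) auto
        ultimately show ?thesis by simp
      qed simp
    qed
    have step: "((\<lambda>mu'. q ^ part_size n mu * GT_value q n' lam' mu') has_sum GT_value q n lam mu) M"
      using s
    proof (elim disjE conjE)
      assume *: "s = 0" "n = Suc n'" "lam n = 0"
      have "M = PiE {1..n'} (\<lambda>i. {mu (Suc i)..mu i})"
        unfolding M_def by (intro PiE_cong) (auto simp: *)
      then show ?thesis
        using GT_value_has_sum_shrink[OF q, of n' mu lam] less.prems * by (simp add: lam'_def)
    next
      assume *: "s = 1" "n' = n" "\<forall>j\<in>{1..n}. 1 \<le> lam j"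
      then show ?thesis
        using GT_value_has_sum_lower[OF q less.prems(2), of lam] by (simp add: lam'_def M_def)
    qed
    have inner: "((\<lambda>T'. q ^ part_size n mu * q ^ GT_size n' lam' T') has_sum
        q ^ part_size n mu * GT_value q n' lam' mu') (GT n' lam' mu')" if "mu' \<in> M" for mu'
      using IH[OF that] by (rule has_sum_cmult_right)
    have "((\<lambda>(mu', T'). q ^ part_size n mu * q ^ GT_size n' lam' T') has_sum GT_value q n lam mu)
        (SIGMA mu' : M. GT n' lam' mu')"
    \<comment> \<open>The terms are nonnegative, so the sums over the fibres and over
      \<open>M\<close> yield summability on the whole set.\<close>
    proof (rule has_sum_SigmaI[OF _ step])
      show "(\<lambda>(mu', T'). q ^ part_size n mu * q ^ GT_size n' lam' T')
          summable_on (SIGMA mu' : M. GT n' lam' mu')"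
        using q by (intro summable_on_SigmaI[OF _ has_sum_imp_summable[OF step]]) (simp_all add: inner)
    qed (simp add: inner)
    then show ?thesis
      unfolding M_def by (subst GT_peel_has_sum[OF s lam'_def])
  qed
qed

section \<open>From the determinant to Schur functions\<close>

lemma Delta_bar_eq_prod: "Delta_bar n x = (\<Prod>j<n. \<Prod>i<j. x (Suc j) - x (Suc i))"
proof -
  have "(\<Prod>j<n. \<Prod>i<j. x (Suc j) - x (Suc i))
      = (\<Prod>(j, i)\<in>(SIGMA j : {..<n}. {..<j}). x (Suc j) - x (Suc i))"
    by (subst prod.Sigma) auto
  also have "\<dots> = Delta_bar n x"
    unfolding Delta_bar_def
    by (rule prod.reindex_bij_witness
        [where i = "\<lambda>(i, j). (j - 1, i - 1)" and j = "\<lambda>(j, i). (Suc i, Suc j)"]) auto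
  finally show ?thesis ..
qed

lemma det_alternant_eq_Delta_bar:
  fixes x :: "nat \<Rightarrow> 'a::idom"
  shows "det (mat n n (\<lambda>(i, j). x (j + 1) ^ (n - (i + 1)))) = (- 1) ^ (n choose 2) * Delta_bar n x"
proof -
  have "det (mat n n (\<lambda>(i, j). x (j + 1) ^ (n - (i + 1))))
      = det (mat n n (\<lambda>(i, j). x (Suc i) ^ (n - Suc j)))"
    by (subst det_transpose[of _ n, symmetric]) (auto intro!: arg_cong[of _ _ det])
  also have "\<dots> = (\<Prod>j<n. \<Prod>i<j. (- 1) * (x (Suc j) - x (Suc i)))"
    by (subst det_vandermonde) simp
  also have "\<dots> = (- 1) ^ (n choose 2) * Delta_bar n x"
    by (simp add: prod.distrib Delta_bar_eq_prod sum_lessThan_choose_two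
        flip: power_sum del: mult_minus_left mult_minus1)
  finally show ?thesis .
qed

text \<open>Each difference is \<open>q ^ (n - Suc j) * (1 - q ^ (j - i))\<close>. For fixed
  \<open>j\<close> the second factors make up \<open>qq_poch q j\<close>, and the powers give the
  summands of \<open>b_stat n (\<delta> n)\<close>.\<close>

lemma Delta_bar_staircase:
  "Delta_bar n (q_pow q (\<delta> n)) = q ^ b_stat n (\<delta> n) * (\<Prod>j = 1..n. qq_poch q (n - j))"
proof -
  have "(\<Prod>i<j. q_pow q (\<delta> n) (Suc j) - q_pow q (\<delta> n) (Suc i))
      = q ^ (j * (n - Suc j)) * qq_poch q j" if "j < n" for j
  proof -
    have "q ^ (n - Suc i) = q ^ (n - Suc j) * q ^ (j - i)" if "i < j" for i
      using that \<open>j < n\<close> by (simp flip: power_add)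
    then have "(\<Prod>i<j. q_pow q (\<delta> n) (Suc j) - q_pow q (\<delta> n) (Suc i))
        = (\<Prod>i<j. q ^ (n - Suc j) * (1 - q ^ (j - i)))"
      by (intro prod.cong) (auto simp: q_pow_def \<delta>_def algebra_simps)
    also have "\<dots> = q ^ (j * (n - Suc j)) * (\<Prod>i<j. 1 - q ^ (j - i))"
      by (simp add: prod.distrib mult.commute flip: power_mult)
    also have "(\<Prod>i<j. 1 - q ^ (j - i)) = qq_poch q j"
      unfolding qq_poch_def
      by (rule prod.reindex_bij_witness[where i = "\<lambda>l. j - l" and j = "\<lambda>i. j - i"]) auto
    finally show ?thesis .
  qed
  then have "Delta_bar n (q_pow q (\<delta> n)) = (\<Prod>j<n. q ^ (j * (n - Suc j)) * qq_poch q j)"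
    by (simp add: Delta_bar_eq_prod)
  also have "\<dots> = q ^ b_stat n (\<delta> n) * (\<Prod>j<n. qq_poch q j)"
    by (simp add: prod.distrib b_stat_def \<delta>_def sum.atLeast1_atMost_eq power_sum)
  also have "(\<Prod>j<n. qq_poch q j) = (\<Prod>j = 1..n. qq_poch q (n - j))"
    by (simp add: prod.atLeast1_atMost_eq prod.nat_diff_reindex)
  finally show ?thesis .
qed

lemma Delta_bar_strict_antimono_nonzero:
  fixes q :: real
  assumes q: "0 < q" "q < 1" and e: "\<And>i j. 1 \<le> i \<Longrightarrow> i < j \<Longrightarrow> j \<le> n \<Longrightarrow> e j < e i"
  shows "Delta_bar n (q_pow q e) \<noteq> 0"
proof -
  have "q ^ e j - q ^ e i \<noteq> 0" if "1 \<le> i" "i < j" "j \<le> n" for i j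
    using power_strict_decreasing[OF e[OF that] q] by simp
  then show ?thesis
    unfolding Delta_bar_eq_prod by (auto simp: q_pow_def)
qed

text \<open>The numerator of the principal specialization has entries \<open>q\<close> to a product
  of two exponents, so transposing swaps the roles of \<open>\<delta> n\<close> and
  \<open>mu + \<delta> n\<close> and makes it a Vandermonde determinant. The signs of numerator and
  denominator cancel.\<close>

lemma schur_staircase_mult_Delta_bar:
  fixes q :: real
  assumes "0 < q" "q < 1"
  shows "schur n mu (q_pow q (\<delta> n)) * Delta_bar n (q_pow q (\<delta> n))
       = Delta_bar n (q_pow q (\<lambda>i. mu i + \<delta> n i))"
proof -
  let ?x = "q_pow q (\<lambda>i. mu i + \<delta> n i)"
  have "det (mat n n (\<lambda>(i, j). q_pow q (\<delta> n) (j + 1) ^ (mu (i + 1) + (n - (i + 1)))))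
      = det (mat n n (\<lambda>(i, j). ?x (j + 1) ^ (n - (i + 1))))"
    by (subst det_transpose[of _ n, symmetric])
       (auto intro!: arg_cong[of _ _ det] simp: q_pow_def \<delta>_def mult.commute simp flip: power_mult)
  moreover have "Delta_bar n (q_pow q (\<delta> n)) \<noteq> 0"
    using assms by (intro Delta_bar_strict_antimono_nonzero) (auto simp: \<delta>_def)
  ultimately show ?thesis
    unfolding schur_def det_alternant_eq_Delta_bar by simp
qed

lemma partition_parts_le_antimono_on:
  assumes "partition_parts_le n \<nu>"
  shows "antimono_on {1..n} \<nu>"
proof (rule monotone_onI)
  fix i j assume "i \<in> {1..n}" "j \<in> {1..n}" "i \<le> j"
  from this(3,1) show "\<nu> j \<le> \<nu> i"
  proof (induction rule: dec_induct)
    case (step m)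
    then have "\<nu> (Suc m) \<le> \<nu> m"
      using assms by (simp add: partition_parts_le_def)
    with step show ?case by simp
  qed simp
qed

theorem theorem8p10:
  fixes q :: real and n :: nat and lam mu :: "nat \<Rightarrow> nat"
  assumes "0 < q" and "q < 1" and "n \<ge> 1"
    and "partition_parts_le n lam" and "partition_parts_le n mu"
  shows "((\<lambda>T. q ^ GT_size n lam T) has_sum
            (q powi (int (part_size n mu) - int (b_stat n lam))
              * schur n mu (q_pow q (\<delta> n))
              * schur n lam (q_pow q (\<lambda>i. mu i + \<delta> n i))
              * (\<Prod>j = 1..n. qq_poch q (n - j) / qq_poch q (lam j + (n - j)))))
          (GT n lam mu)
       \<and> ((\<lambda>T. q ^ GT_size n lam T) has_sum
            (q powi (int (part_size n mu) - int (b_stat n (\<lambda>i. \<delta> n i + lam i)))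
              / (\<Prod>j = 1..n. qq_poch q (lam j + (n - j)))
              * schur n lam (q_pow q (\<lambda>i. mu i + \<delta> n i))
              * Delta_bar n (q_pow q (\<lambda>i. mu i + \<delta> n i))))
          (GT n lam mu)"
proof -
  let ?x = "q_pow q (\<lambda>i. mu i + \<delta> n i)"
  let ?D = "Delta_bar n (q_pow q (\<delta> n))"
  let ?S = "schur n lam ?x"
  let ?P = "\<Prod>j = 1..n. qq_poch q (lam j + (n - j))"
  note lam = partition_parts_le_antimono_on[OF assms(4)]
    and mu = partition_parts_le_antimono_on[OF assms(5)]
  \<comment> \<open>Needed to cancel the denominator of \<open>schur\<close>, which would otherwise
    be a division by 0.\<close>
  have "Delta_bar n ?x \<noteq> 0"
  proof (rule Delta_bar_strict_antimono_nonzero[OF assms(1,2)])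
    fix i j assume "1 \<le> i" "i < j" "j \<le> n"
    then show "mu j + \<delta> n j < mu i + \<delta> n i"
      using monotone_onD[OF mu, of i j] by (simp add: \<delta>_def)
  qed
  have powi: "q powi (int a - int b) = q ^ a / q ^ b" for a b
    using assms(1) by (simp add: power_int_diff)
  from \<open>Delta_bar n ?x \<noteq> 0\<close> have "?S * Delta_bar n ?x = (- 1) ^ (n choose 2)
      * det (mat n n (\<lambda>(i, j). ?x (j + 1) ^ (lam (i + 1) + (n - (i + 1)))))"
    unfolding schur_def det_alternant_eq_Delta_bar
    by (simp add: field_simps flip: power_mult_distrib)
  also have "det (mat n n (\<lambda>(i, j). ?x (j + 1) ^ (lam (i + 1) + (n - (i + 1)))))
      = det (mat n n (\<lambda>(i, j). q ^ ((lam (Suc i) + \<delta> n (Suc i)) * (mu (Suc j) + \<delta> n (Suc j)))))"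
    by (simp add: q_pow_def \<delta>_def mult.commute flip: power_mult)
  finally have second: "GT_value q n lam mu
      = q ^ part_size n mu / q ^ b_stat n (\<lambda>i. \<delta> n i + lam i) / ?P * (?S * Delta_bar n ?x)"
    by (simp add: GT_value_def \<delta>_def)
  \<comment> \<open>The staircase part of the exponent cancels against the power of \<open>q\<close>
    in \<open>Delta_bar_staircase\<close>, whose \<open>qq_poch\<close> factors become the
    numerators of the first form.\<close>
  have "b_stat n (\<lambda>i. \<delta> n i + lam i) = b_stat n (\<delta> n) + b_stat n lam"
    by (simp add: b_stat_def sum.distrib distrib_left)
  then have "GT_value q n lam mu
      = q ^ part_size n mu / q ^ b_stat n lam / q ^ b_stat n (\<delta> n) / ?P * ?S
        * (schur n mu (q_pow q (\<delta> n)) * ?D)"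
    unfolding second schur_staircase_mult_Delta_bar[OF assms(1,2)] by (simp add: power_add mult_ac)
  also have "\<dots> = q ^ part_size n mu / q ^ b_stat n lam * schur n mu (q_pow q (\<delta> n)) * ?S
        * (\<Prod>j = 1..n. qq_poch q (n - j) / qq_poch q (lam j + (n - j)))"
    using assms(1) by (simp add: Delta_bar_staircase prod_dividef)
  finally have first: "GT_value q n lam mu
      = q ^ part_size n mu / q ^ b_stat n lam * schur n mu (q_pow q (\<delta> n)) * ?S
        * (\<Prod>j = 1..n. qq_poch q (n - j) / qq_poch q (lam j + (n - j)))" .
  note GT_has_sum = GT_has_sum[OF assms(1,2) lam mu]
  show ?thesis
    using GT_has_sum[unfolded first] GT_has_sum[unfolded second] by (simp only: powi mult.assoc)
qed

end
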